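(* Let $\gamma\ge 0$ and $\beta_1,\dots,\beta_n>0$. Let $f:\mathbb{R}^n\to\mathbb{R}$ be differentiable with minimizer $x^*$, $\alpha$-strongly convex ($\alpha>0$) with respect to the norm $\|x\|_{[1-\gamma]}=\sqrt{\sum_{i=1}^n\beta_i^{1-\gamma}x_i^2}$, and such that $u\in\mathbb{R}\mapsto f(x+ue_i)$ is $\beta_i$-smooth for any $i\in\{1,\dots,n\}$ and $x\in\mathbb{R}^n$. Let $\kappa_\gamma=\frac{\sum_{i=1}^n\beta_i^\gamma}{\alpha}$. Let RCD($\gamma$) be defined by an arbitrary (deterministic) $x_1\in\mathbb{R}^n$ and $$x_{s+1}=x_s-\frac{1}{\beta_{i_s}}\nabla_{i_s}f(x_s)\,e_{i_s},\qquad s\ge 1,$$ where the $i_s$ are drawn independently from the distribution $p_\gamma(i)=\frac{\beta_i^\gamma}{\sum_{j=1}^n\beta_j^\gamma}$, $i\in\{1,\dots,n\}$. Then for every $t\ge 0$, $$\mathbb{E}f(x_{t+1})-f(x^* )\le\left(1-\frac{1}{\kappa_\gamma}\right)^t\left(f(x_1)-f(x^* )\right).$$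
   Context: $e_1,\dots,e_n$ is the canonical basis of $\mathbb{R}^n$ and $\nabla_if(x)=\frac{\partial f}{\partial x_i}(x)$. $f$ is $\alpha$-strongly convex w.r.t. a norm $\|\cdot\|$ if $f(x)-f(y)\le\nabla f(x)^\top(x-y)-\frac\alpha2\|x-y\|^2$ for all $x,y\in\mathbb{R}^n$. The function $u\mapsto f(x+ue_i)$ being $\beta_i$-smooth for every $x$ means $|\nabla_if(x+ue_i)-\nabla_if(x)|\le\beta_i|u|$ for all $x\in\mathbb{R}^n$, $u\in\mathbb{R}$. *)

theory Defs
  imports "HOL-Probability.Probability"
begin

definition partial_deriv :: "(real ^ 'n \<Rightarrow> real) \<Rightarrow> 'n::finite \<Rightarrow> real ^ 'n \<Rightarrow> real" where
  "partial_deriv f i x = deriv (\<lambda>u. f (x + u *\<^sub>R axis i 1)) 0"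

definition grad :: "(real ^ 'n::finite \<Rightarrow> real) \<Rightarrow> real ^ 'n \<Rightarrow> real ^ 'n" where
  "grad f x = (\<chi> i. partial_deriv f i x)"

(* In the following definition, N plays the role of a norm. *)
definition strongly_convex_wrt ::
  "(real ^ 'n \<Rightarrow> real) \<Rightarrow> real \<Rightarrow> (real ^ 'n::finite \<Rightarrow> real) \<Rightarrow> bool" where
  "strongly_convex_wrt N \<alpha> f \<longleftrightarrow>
     (\<forall>x y. f x - f y \<le> grad f x \<bullet> (x - y) - \<alpha> / 2 * (N (x - y))\<^sup>2)"

definition coord_smooth :: "(real ^ 'n \<Rightarrow> real) \<Rightarrow> 'n::finite \<Rightarrow> real \<Rightarrow> bool" where
  "coord_smooth f i b \<longleftrightarrow>
     (\<forall>x u. \<bar>partial_deriv f i (x + u *\<^sub>R axis i 1) - partial_deriv f i x\<bar> \<le> b * \<bar>u\<bar>)"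

(* The norm written with index [q]: the weight of coordinate i is the q-th real power of beta_i. *)
definition wnorm :: "('n \<Rightarrow> real) \<Rightarrow> real \<Rightarrow> real ^ 'n::finite \<Rightarrow> real" where
  "wnorm \<beta> q x = sqrt (\<Sum>i\<in>UNIV. \<beta> i powr q * (x $ i)\<^sup>2)"

definition kappa :: "('n::finite \<Rightarrow> real) \<Rightarrow> real \<Rightarrow> real \<Rightarrow> real" where
  "kappa \<beta> \<alpha> \<gamma> = (\<Sum>i\<in>UNIV. \<beta> i powr \<gamma>) / \<alpha>"

definition rcd_prob :: "('n::finite \<Rightarrow> real) \<Rightarrow> real \<Rightarrow> 'n \<Rightarrow> real" where
  "rcd_prob \<beta> \<gamma> i = \<beta> i powr \<gamma> / (\<Sum>j\<in>UNIV. \<beta> j powr \<gamma>)"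

(* Time starts at 1: the values of I and X at index 0 are irrelevant.
   Measurability of each I s is part of indep_vars. *)
definition rcd_process ::
  "'w measure \<Rightarrow> ('n::finite \<Rightarrow> real) \<Rightarrow> real \<Rightarrow> (real ^ 'n \<Rightarrow> real) \<Rightarrow> real ^ 'n
    \<Rightarrow> (nat \<Rightarrow> 'w \<Rightarrow> 'n) \<Rightarrow> (nat \<Rightarrow> 'w \<Rightarrow> real ^ 'n) \<Rightarrow> bool" where
  "rcd_process M \<beta> \<gamma> f x1 I X \<longleftrightarrow>
     prob_space.indep_vars M (\<lambda>_. count_space UNIV) I {1..} \<and>
     (\<forall>s\<ge>1. \<forall>j. measure M {\<omega> \<in> space M. I s \<omega> = j} = rcd_prob \<beta> \<gamma> j) \<and>
     (\<forall>\<omega>\<in>space M. X 1 \<omega> = x1) \<and>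
     (\<forall>s\<ge>1. \<forall>\<omega>\<in>space M. X (s + 1) \<omega> =
        X s \<omega> - (1 / \<beta> (I s \<omega>) * partial_deriv f (I s \<omega>) (X s \<omega>)) *\<^sub>R axis (I s \<omega>) 1)"

end

theory Submission
  imports Defs
begin

text \<open>
  The proof combines three facts. Write \<open>S\<close> for the sum of the weights \<open>\<beta> i powr \<gamma>\<close>,
  and call \<open>f x - f xstar\<close> the gap of \<open>x\<close>.

  \<^item> Smoothness along coordinate \<open>i\<close> bounds \<open>f\<close> on the line through \<open>x\<close> in direction \<open>i\<close> by a
    parabola with curvature \<open>\<beta> i\<close>. The update in coordinate \<open>i\<close> minimizes that parabola, hence
    decreases \<open>f\<close> by at least \<open>(partial_deriv f i x)\<^sup>2 / (2 * \<beta> i)\<close> (\<open>coordinate_step_decrease\<close>).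
    Averaged over the sampling law, the guaranteed decrease is \<open>1 / (2 * S)\<close> times the squared
    weighted norm of the gradient with weights \<open>\<beta> i powr (\<gamma> - 1)\<close>.

  \<^item> Those weights are the reciprocals of the ones in the norm for which \<open>f\<close> is strongly convex, so
    the two norms are dual to each other. Strong convexity therefore bounds the gap by
    \<open>1 / (2 * \<alpha>)\<close> times the same squared norm of the gradient (\<open>gap_le_dual_norm_grad\<close>), and one
    random step contracts the gap in mean by the factor \<open>1 - \<alpha> / S\<close>
    (\<open>mean_gap_contraction\<close>).

  \<^item> The state reached before step \<open>s\<close> depends only on the indices drawn before, so it is
    independent of the index drawn at step \<open>s\<close>, and the one-step contraction can be integrated
    over the current state and iterated (\<open>expectation_iterate_le\<close>).

  Iterating an inequality requires the factor to be nonnegative. This is the inequality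
  \<open>\<alpha> \<le> S\<close>, which holds because the curvature of \<open>f\<close> along a coordinate direction is bounded below
  by strong convexity and above by smoothness (\<open>strong_convexity_le_weight\<close>).
\<close>

section \<open>Contracting potentials along independent random steps\<close>

primrec iterate_steps :: "('i \<Rightarrow> 'b \<Rightarrow> 'b) \<Rightarrow> 'b \<Rightarrow> (nat \<Rightarrow> 'i) \<Rightarrow> nat \<Rightarrow> 'b" where
  "iterate_steps T x h 0 = x"
| "iterate_steps T x h (Suc k) = T (h (Suc k)) (iterate_steps T x h k)"

lemma iterate_steps_cong:
  "(\<And>s. s \<in> {1..k} \<Longrightarrow> h s = h' s) \<Longrightarrow> iterate_steps T x h k = iterate_steps T x h' k"
  by (induction k) auto

context prob_space
begin

text \<open>
  A history over finitely many times with values in a finite type has only finitely many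
  possible values. Every real function of the history is therefore measurable and bounded.
\<close>

lemma borel_measurable_PiM_count_space:
  fixes A :: "nat set" and V :: "(nat \<Rightarrow> 'i::finite) \<Rightarrow> real"
  assumes "finite A"
  shows "V \<in> borel_measurable (PiM A (\<lambda>_. count_space (UNIV :: 'i set)))"
  by (subst count_space_PiM_finite) (use assms in \<open>auto intro: countable_finite\<close>)

lemma integrable_function_of_history:
  fixes I :: "nat \<Rightarrow> 'a \<Rightarrow> 'i::finite" and V :: "(nat \<Rightarrow> 'i) \<Rightarrow> real"
  assumes "finite A" and "\<And>s. s \<in> A \<Longrightarrow> I s \<in> measurable M (count_space UNIV)"
  shows "integrable M (\<lambda>\<omega>. V (restrict (\<lambda>s. I s \<omega>) A))"
proof -
  let ?R = "PiE A (\<lambda>_. UNIV :: 'i set)"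
  have fin: "finite (V ` ?R)"
    using assms(1) by (intro finite_imageI finite_PiE) auto
  have meas: "(\<lambda>\<omega>. V (restrict (\<lambda>s. I s \<omega>) A)) \<in> borel_measurable M"
    by (rule measurable_compose[OF measurable_restrict
          borel_measurable_PiM_count_space[OF assms(1)]]) (use assms(2) in auto)
  show ?thesis
  proof (rule integrable_const_bound[where B = "Max (abs ` V ` ?R)"])
    show "AE \<omega> in M. norm (V (restrict (\<lambda>s. I s \<omega>) A)) \<le> Max (abs ` V ` ?R)"
      using fin by (intro AE_I2) (auto intro!: Max_ge)
  qed (rule meas)
qed

text \<open>
  Conditioning on the history, in elementary form: split the expectation according to the value
  of the fresh index and use independence in each of the finitely many terms.
\<close>

lemma expectation_fresh_index:
  fixes I :: "nat \<Rightarrow> 'a \<Rightarrow> 'i::finite" and V :: "'i \<Rightarrow> (nat \<Rightarrow> 'i) \<Rightarrow> real"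
  assumes indep: "indep_vars (\<lambda>_. count_space UNIV) I J"
    and A: "finite A" "A \<subseteq> J" "s \<in> J" "s \<notin> A"
  shows "expectation (\<lambda>\<omega>. V (I s \<omega>) (restrict (\<lambda>r. I r \<omega>) A))
    = expectation (\<lambda>\<omega>. \<Sum>i\<in>UNIV. prob {\<omega> \<in> space M. I s \<omega> = i} * V i (restrict (\<lambda>r. I r \<omega>) A))"
proof -
  define H where "H = (\<lambda>\<omega>. restrict (\<lambda>r. I r \<omega>) A)"
  have meas: "I r \<in> measurable M (count_space UNIV)" if "r \<in> J" for r
    using indep that by (auto simp: indep_vars_def)
  have intH: "integrable M (\<lambda>\<omega>. W (H \<omega>))" for W :: "(nat \<Rightarrow> 'i) \<Rightarrow> real"
    unfolding H_def by (rule integrable_function_of_history) (use A meas in auto)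
  define ind where "ind = (\<lambda>i \<omega>. if I s \<omega> = i then 1 else 0 :: real)"
  have ev: "{\<omega> \<in> space M. I s \<omega> = i} \<in> events" for i
    using measurable_sets[OF meas[OF A(3)], of "{i}"]
    by (simp add: vimage_def Int_def conj_commute)
  have ind_eq: "ind i \<omega> = indicator {\<omega> \<in> space M. I s \<omega> = i} \<omega>" if "\<omega> \<in> space M" for i \<omega>
    using that by (simp add: ind_def)
  have int_ind: "integrable M (ind i)" for i
    by (subst Bochner_Integration.integrable_cong[OF refl ind_eq])
      (auto intro!: integrable_real_indicator ev simp: emeasure_eq_measure)
  have exp_ind: "expectation (ind i) = prob {\<omega> \<in> space M. I s \<omega> = i}" for i
    by (subst Bochner_Integration.integral_cong[OF refl ind_eq]) (use ev in auto)
  have indep_term: "indep_var borel (ind i) borel (\<lambda>\<omega>. V i (H \<omega>))" for i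
  proof -
    have "indep_var (PiM {s} (\<lambda>_. count_space UNIV)) (\<lambda>\<omega>. restrict (\<lambda>r. I r \<omega>) {s})
        (PiM A (\<lambda>_. count_space UNIV)) H"
      unfolding H_def by (rule indep_var_restrict[OF indep]) (use A in auto)
    from indep_var_compose[OF this borel_measurable_PiM_count_space
        borel_measurable_PiM_count_space[OF A(1)],
        of "\<lambda>h. if h s = i then 1 else 0" "V i"]
    show ?thesis by (simp add: comp_def ind_def)
  qed
  have "expectation (\<lambda>\<omega>. V (I s \<omega>) (H \<omega>)) = expectation (\<lambda>\<omega>. \<Sum>i\<in>UNIV. ind i \<omega> * V i (H \<omega>))"
    by (simp add: ind_def if_distrib[of "\<lambda>x. x * _"] cong: if_cong)
  also have "\<dots> = (\<Sum>i\<in>UNIV. expectation (\<lambda>\<omega>. ind i \<omega> * V i (H \<omega>)))"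
    by (intro Bochner_Integration.integral_sum indep_var_integrable[OF indep_term] int_ind intH)
  also have "\<dots> = (\<Sum>i\<in>UNIV. prob {\<omega> \<in> space M. I s \<omega> = i} * expectation (\<lambda>\<omega>. V i (H \<omega>)))"
    by (intro sum.cong refl)
      (simp add: indep_var_lebesgue_integral[OF indep_term int_ind intH] exp_ind)
  also have "\<dots> = expectation (\<lambda>\<omega>. \<Sum>i\<in>UNIV. prob {\<omega> \<in> space M. I s \<omega> = i} * V i (H \<omega>))"
    by (subst Bochner_Integration.integral_sum) (auto intro: intH)
  finally show ?thesis by (simp add: H_def)
qed

text \<open>
  Nonnegativity of \<open>c\<close> is what allows the bound for the first \<open>t\<close> steps to be multiplied by the
  factor of the next one.
\<close>

lemma expectation_iterate_le:
  fixes I :: "nat \<Rightarrow> 'a \<Rightarrow> 'i::finite" and T :: "'i \<Rightarrow> 'b \<Rightarrow> 'b" and V :: "'b \<Rightarrow> real"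
  assumes indep: "indep_vars (\<lambda>_. count_space UNIV) I {1..}"
    and law: "\<And>s i. s \<ge> 1 \<Longrightarrow> prob {\<omega> \<in> space M. I s \<omega> = i} = p i"
    and contr: "\<And>x. (\<Sum>i\<in>UNIV. p i * V (T i x)) \<le> c * V x"
    and "c \<ge> 0"
  shows "expectation (\<lambda>\<omega>. V (iterate_steps T x (\<lambda>s. I s \<omega>) t)) \<le> c ^ t * V x"
proof (induction t)
  case 0
  then show ?case by (simp add: prob_space)
next
  case (Suc t)
  define H where "H = (\<lambda>\<omega>. restrict (\<lambda>s. I s \<omega>) {1..t})"
  have past: "iterate_steps T x (\<lambda>s. I s \<omega>) t = iterate_steps T x (H \<omega>) t" for \<omega>
    by (rule iterate_steps_cong) (simp add: H_def)
  have intH: "integrable M (\<lambda>\<omega>. W (H \<omega>))" for W :: "(nat \<Rightarrow> 'i) \<Rightarrow> real"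
    unfolding H_def
    by (rule integrable_function_of_history) (use indep in \<open>auto simp: indep_vars_def\<close>)
  have "expectation (\<lambda>\<omega>. V (iterate_steps T x (\<lambda>s. I s \<omega>) (Suc t)))
      = expectation (\<lambda>\<omega>. V (T (I (Suc t) \<omega>) (iterate_steps T x (H \<omega>) t)))"
    by (simp add: past)
  also have "\<dots> = expectation (\<lambda>\<omega>. \<Sum>i\<in>UNIV. p i * V (T i (iterate_steps T x (H \<omega>) t)))"
    using expectation_fresh_index[OF indep, of "{1..t}" "Suc t"
        "\<lambda>i h. V (T i (iterate_steps T x h t))"]
    by (simp add: H_def law)
  also have "\<dots> \<le> expectation (\<lambda>\<omega>. c * V (iterate_steps T x (H \<omega>) t))"
    by (intro integral_mono intH contr)
  also have "\<dots> = c * expectation (\<lambda>\<omega>. V (iterate_steps T x (\<lambda>s. I s \<omega>) t))"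
    by (simp add: past)
  also have "\<dots> \<le> c * (c ^ t * V x)"
    using Suc.IH \<open>c \<ge> 0\<close> by (rule mult_left_mono)
  finally show ?case by simp
qed

end

section \<open>Coordinate steps decrease a coordinatewise smooth function\<close>

lemma has_partial_deriv:
  fixes f :: "real ^ 'n::finite \<Rightarrow> real"
  assumes "\<And>x. f differentiable (at x)"
  shows "((\<lambda>u. f (x + u *\<^sub>R axis i 1)) has_real_derivative
           partial_deriv f i (x + u *\<^sub>R axis i 1)) (at u)"
proof -
  have "(\<lambda>v. f ((x + u *\<^sub>R axis i 1) + v *\<^sub>R axis i 1)) differentiable (at 0)"
    by (rule differentiable_compose[of f]) (auto intro!: assms derivative_intros)
  then have "((\<lambda>v. f ((x + u *\<^sub>R axis i 1) + v *\<^sub>R axis i 1)) has_real_derivative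
      partial_deriv f i (x + u *\<^sub>R axis i 1)) (at 0)"
    unfolding partial_deriv_def by (simp add: DERIV_deriv_iff_real_differentiable)
  then have "((\<lambda>v. f (x + (v + u) *\<^sub>R axis i 1)) has_real_derivative
      partial_deriv f i (x + u *\<^sub>R axis i 1)) (at 0)"
    by (simp add: algebra_simps)
  then show ?thesis
    using DERIV_shift[of "\<lambda>v. f (x + v *\<^sub>R axis i 1)" _ 0 u] by simp
qed

text \<open>
  The difference between \<open>g\<close> and the parabola has a derivative of sign opposite to the sign of
  the argument, so it is largest at \<open>0\<close>.
\<close>

lemma le_parabola_of_lipschitz_derivative:
  fixes g g' :: "real \<Rightarrow> real"
  assumes deriv: "\<And>v. (g has_real_derivative g' v) (at v)"
    and lip: "\<And>v. \<bar>g' v - g' 0\<bar> \<le> b * \<bar>v\<bar>"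
  shows "g u \<le> g 0 + g' 0 * u + b / 2 * u\<^sup>2"
proof -
  define h where "h = (\<lambda>v. g v - g' 0 * v - b / 2 * v\<^sup>2)"
  have h: "(h has_real_derivative (g' v - g' 0 - b * v)) (at v)" for v
    unfolding h_def by (auto intro!: derivative_eq_intros deriv)
  have "h u \<le> h 0"
  proof (cases "u \<ge> 0")
    case True
    then show ?thesis
    proof (rule DERIV_nonpos_imp_nonincreasing)
      fix v :: real assume "0 \<le> v"
      then show "\<exists>y. (h has_real_derivative y) (at v) \<and> y \<le> 0"
        using h[of v] lip[of v] by (intro exI[of _ "g' v - g' 0 - b * v"]) auto
    qed
  next
    case False
    then have "u \<le> 0" by simp
    then show ?thesis
    proof (rule DERIV_nonneg_imp_nondecreasing)
      fix v :: real assume "v \<le> 0"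
      then show "\<exists>y. (h has_real_derivative y) (at v) \<and> y \<ge> 0"
        using h[of v] lip[of v] by (intro exI[of _ "g' v - g' 0 - b * v"]) auto
    qed
  qed
  then show ?thesis by (simp add: h_def)
qed

definition coordinate_step ::
  "('n::finite \<Rightarrow> real) \<Rightarrow> (real ^ 'n \<Rightarrow> real) \<Rightarrow> 'n \<Rightarrow> real ^ 'n \<Rightarrow> real ^ 'n" where
  "coordinate_step \<beta> f i x = x - (1 / \<beta> i * partial_deriv f i x) *\<^sub>R axis i 1"

text \<open>The step goes to the minimizer of the parabola that bounds \<open>f\<close> along coordinate \<open>i\<close>.\<close>

lemma coordinate_step_decrease:
  fixes f :: "real ^ 'n::finite \<Rightarrow> real"
  assumes diff: "\<And>x. f differentiable (at x)"
    and smooth: "coord_smooth f i (\<beta> i)" and pos: "\<beta> i > 0"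
  shows "f (coordinate_step \<beta> f i x) \<le> f x - (partial_deriv f i x)\<^sup>2 / (2 * \<beta> i)"
proof -
  let ?d = "partial_deriv f i x"
  have "f (x + u *\<^sub>R axis i 1) \<le> f x + ?d * u + \<beta> i / 2 * u\<^sup>2" for u
    using le_parabola_of_lipschitz_derivative[OF has_partial_deriv[OF diff, of x i], of "\<beta> i" u]
      smooth by (simp add: coord_smooth_def)
  from this[of "- (?d / \<beta> i)"]
  have "f (coordinate_step \<beta> f i x) \<le> f x + ?d * (- (?d / \<beta> i)) + \<beta> i / 2 * (- (?d / \<beta> i))\<^sup>2"
    by (simp add: coordinate_step_def)
  also have "\<dots> = f x - ?d\<^sup>2 / (2 * \<beta> i)"
    using pos by (simp add: field_simps power2_eq_square)
  finally show ?thesis .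
qed

section \<open>Strong convexity with respect to a weighted norm\<close>

lemma wnorm_power2: "(wnorm \<beta> q x)\<^sup>2 = (\<Sum>i\<in>UNIV. \<beta> i powr q * (x $ i)\<^sup>2)"
  unfolding wnorm_def by (rule real_sqrt_pow2) (auto intro: sum_nonneg)

text \<open>
  In each coordinate, the concave parabola in the displacement from \<open>y\<close> on the right-hand side of
  strong convexity is at most its maximum, which is a multiple of the squared partial derivative.
\<close>

lemma gap_le_dual_norm_grad:
  fixes f :: "real ^ 'n::finite \<Rightarrow> real"
  assumes sc: "strongly_convex_wrt (wnorm \<beta> q) \<alpha> f" and "\<alpha> > 0" and pos: "\<And>i. \<beta> i > 0"
  shows "f x - f y \<le> 1 / (2 * \<alpha>) * (\<Sum>i\<in>UNIV. \<beta> i powr (- q) * (partial_deriv f i x)\<^sup>2)"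
proof -
  have young: "g * d - \<alpha> / 2 * (w * d\<^sup>2) \<le> 1 / (2 * \<alpha>) * (g\<^sup>2 / w)" if "w > 0" for g d w :: real
  proof -
    have "1 / (2 * \<alpha>) * (g\<^sup>2 / w) - (g * d - \<alpha> / 2 * (w * d\<^sup>2)) = (g - \<alpha> * w * d)\<^sup>2 / (2 * \<alpha> * w)"
      using \<open>\<alpha> > 0\<close> that by (simp add: field_simps power2_eq_square)
    also have "\<dots> \<ge> 0"
      using \<open>\<alpha> > 0\<close> that by simp
    finally show ?thesis by simp
  qed
  have "f x - f y \<le> grad f x \<bullet> (x - y) - \<alpha> / 2 * (wnorm \<beta> q (x - y))\<^sup>2"
    using sc by (simp add: strongly_convex_wrt_def)
  also have "\<dots> = (\<Sum>i\<in>UNIV. partial_deriv f i x * (x - y) $ i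
      - \<alpha> / 2 * (\<beta> i powr q * ((x - y) $ i)\<^sup>2))"
    by (simp add: wnorm_power2 inner_vec_def grad_def sum_subtractf sum_distrib_left)
  also have "\<dots> \<le> (\<Sum>i\<in>UNIV. 1 / (2 * \<alpha>) * ((partial_deriv f i x)\<^sup>2 / \<beta> i powr q))"
  proof (intro sum_mono young)
    show "\<beta> i powr q > 0" for i
      using pos[of i] by simp
  qed
  also have "\<dots> = 1 / (2 * \<alpha>) * (\<Sum>i\<in>UNIV. \<beta> i powr (- q) * (partial_deriv f i x)\<^sup>2)"
    by (simp add: sum_distrib_left powr_minus_divide)
  finally show ?thesis .
qed

text \<open>
  Adding the strong convexity inequalities for two points that differ by a unit coordinate vector
  bounds the increase of the partial derivative between them from below; smoothness bounds the
  same increase from above.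
\<close>

lemma strong_convexity_le_weight:
  fixes f :: "real ^ 'n::finite \<Rightarrow> real"
  assumes sc: "strongly_convex_wrt (wnorm \<beta> (1 - \<gamma>)) \<alpha> f"
    and smooth: "coord_smooth f i (\<beta> i)" and pos: "\<beta> i > 0"
  shows "\<alpha> \<le> \<beta> i powr \<gamma>"
proof -
  define e :: "real ^ 'n" where "e = axis i 1"
  have norm_e: "(wnorm \<beta> (1 - \<gamma>) e)\<^sup>2 = \<beta> i powr (1 - \<gamma>)"
    by (simp add: wnorm_power2 e_def axis_def if_distrib[of "\<lambda>x. x\<^sup>2"]
        if_distrib[of "\<lambda>x. _ * x"] cong: if_cong)
  have norm_minus_e: "(wnorm \<beta> (1 - \<gamma>) (- e))\<^sup>2 = (wnorm \<beta> (1 - \<gamma>) e)\<^sup>2"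
    by (simp add: wnorm_power2)
  have grad_e: "grad f x \<bullet> e = partial_deriv f i x" for x
    by (simp add: e_def inner_axis grad_def)
  have "f e - f 0 \<le> grad f e \<bullet> (e - 0) - \<alpha> / 2 * (wnorm \<beta> (1 - \<gamma>) (e - 0))\<^sup>2"
    and "f 0 - f e \<le> grad f 0 \<bullet> (0 - e) - \<alpha> / 2 * (wnorm \<beta> (1 - \<gamma>) (0 - e))\<^sup>2"
    using sc unfolding strongly_convex_wrt_def by blast+
  then have "\<alpha> * \<beta> i powr (1 - \<gamma>) \<le> partial_deriv f i e - partial_deriv f i 0"
    by (simp add: norm_minus_e norm_e grad_e)
  also have "\<dots> \<le> \<beta> i"
    using smooth[unfolded coord_smooth_def, rule_format, of 0 1] by (simp add: e_def)
  also have "\<beta> i = \<beta> i powr \<gamma> * \<beta> i powr (1 - \<gamma>)"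
    using pos by (simp flip: powr_add)
  finally show ?thesis
    using pos by simp
qed

section \<open>Linear convergence of randomized coordinate descent\<close>

lemma sum_powr_pos:
  fixes \<beta> :: "'n::finite \<Rightarrow> real"
  assumes "\<And>i. \<beta> i > 0"
  shows "(\<Sum>i\<in>UNIV. \<beta> i powr \<gamma>) > 0"
proof (rule sum_pos)
  show "\<beta> i powr \<gamma> > 0" for i
    using assms[of i] by simp
qed auto

lemma sum_rcd_prob:
  assumes "\<And>i. \<beta> i > 0"
  shows "(\<Sum>i\<in>UNIV. rcd_prob \<beta> \<gamma> i) = 1"
  using sum_powr_pos[where \<beta> = \<beta> and \<gamma> = \<gamma>, OF assms] by (simp add: rcd_prob_def flip: sum_divide_distrib)

lemma kappa_ge_1:
  fixes f :: "real ^ 'n::finite \<Rightarrow> real"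
  assumes "strongly_convex_wrt (wnorm \<beta> (1 - \<gamma>)) \<alpha> f"
    and "\<And>i. coord_smooth f i (\<beta> i)" and "\<And>i. \<beta> i > 0" and "\<alpha> > 0"
  shows "kappa \<beta> \<alpha> \<gamma> \<ge> 1"
proof -
  \<comment> \<open>A single weight already dominates \<open>\<alpha>\<close>, so the choice of the coordinate is immaterial.\<close>
  have "\<alpha> \<le> \<beta> undefined powr \<gamma>"
    using assms by (intro strong_convexity_le_weight)
  also have "\<dots> \<le> (\<Sum>i\<in>UNIV. \<beta> i powr \<gamma>)"
    by (rule member_le_sum) auto
  finally show ?thesis
    using \<open>\<alpha> > 0\<close> by (simp add: kappa_def)
qed

text \<open>
  The sampling weight \<open>\<beta> i powr \<gamma>\<close> turns the guaranteed decrease with weight \<open>1 / \<beta> i\<close> into one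
  with weight \<open>\<beta> i powr (\<gamma> - 1)\<close>, which is the weight of the dual norm in
  \<open>gap_le_dual_norm_grad\<close>. This match is the reason for the exponent \<open>1 - \<gamma>\<close> in the norm.
\<close>

lemma mean_gap_contraction:
  fixes f :: "real ^ 'n::finite \<Rightarrow> real"
  assumes diff: "\<And>x. f differentiable (at x)"
    and sc: "strongly_convex_wrt (wnorm \<beta> (1 - \<gamma>)) \<alpha> f"
    and smooth: "\<And>i. coord_smooth f i (\<beta> i)"
    and pos: "\<And>i. \<beta> i > 0" and "\<alpha> > 0"
  shows "(\<Sum>i\<in>UNIV. rcd_prob \<beta> \<gamma> i * (f (coordinate_step \<beta> f i x) - f y))
    \<le> (1 - 1 / kappa \<beta> \<alpha> \<gamma>) * (f x - f y)"
proof -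
  let ?p = "rcd_prob \<beta> \<gamma>"
  define S where "S = (\<Sum>i\<in>UNIV. \<beta> i powr \<gamma>)"
  define D where "D = (\<Sum>i\<in>UNIV. \<beta> i powr (\<gamma> - 1) * (partial_deriv f i x)\<^sup>2)"
  have "S > 0"
    unfolding S_def using pos by (rule sum_powr_pos)
  have p_nonneg: "?p i \<ge> 0" for i
    using \<open>S > 0\<close> by (simp add: rcd_prob_def flip: S_def)
  have gap: "f x - f y \<le> 1 / (2 * \<alpha>) * D"
    using gap_le_dual_norm_grad[OF sc \<open>\<alpha> > 0\<close> pos, of x y] by (simp add: D_def)
  have weight: "?p i * (d / (2 * \<beta> i)) = 1 / (2 * S) * (\<beta> i powr (\<gamma> - 1) * d)" for i d
    using pos[of i] by (simp add: rcd_prob_def powr_diff flip: S_def)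
  have "(\<Sum>i\<in>UNIV. ?p i * (f (coordinate_step \<beta> f i x) - f y))
      \<le> (\<Sum>i\<in>UNIV. ?p i * (f x - f y - (partial_deriv f i x)\<^sup>2 / (2 * \<beta> i)))"
  proof (intro sum_mono mult_left_mono p_nonneg)
    show "f (coordinate_step \<beta> f i x) - f y
        \<le> f x - f y - (partial_deriv f i x)\<^sup>2 / (2 * \<beta> i)" for i
      using coordinate_step_decrease[where f = f and \<beta> = \<beta> and i = i and x = x,
          OF diff smooth pos] by simp
  qed
  also have "\<dots> = (\<Sum>i\<in>UNIV. ?p i) * (f x - f y) - 1 / (2 * S) * D"
    by (simp only: right_diff_distrib weight sum_subtractf sum_distrib_left sum_distrib_right D_def)
  also have "\<dots> = f x - f y - \<alpha> / S * (1 / (2 * \<alpha>) * D)"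
    using \<open>\<alpha> > 0\<close> by (simp add: sum_rcd_prob[OF pos])
  also have "\<dots> \<le> f x - f y - \<alpha> / S * (f x - f y)"
    using mult_left_mono[OF gap, of "\<alpha> / S"] \<open>\<alpha> > 0\<close> \<open>S > 0\<close> by simp
  also have "\<dots> = (1 - 1 / kappa \<beta> \<alpha> \<gamma>) * (f x - f y)"
    by (simp add: kappa_def left_diff_distrib flip: S_def)
  finally show ?thesis .
qed

lemma rcd_process_eq_iterate_steps:
  assumes "rcd_process M \<beta> \<gamma> f x1 I X" and "\<omega> \<in> space M"
  shows "X (t + 1) \<omega> = iterate_steps (coordinate_step \<beta> f) x1 (\<lambda>s. I s \<omega>) t"
  using assms by (induction t) (auto simp: rcd_process_def coordinate_step_def)

theorem theorem6p8:
  fixes f :: "real ^ 'n::finite \<Rightarrow> real" and \<beta> :: "'n \<Rightarrow> real" and \<alpha> \<gamma> :: real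
    and xstar x1 :: "real ^ 'n" and M :: "'w measure"
    and I :: "nat \<Rightarrow> 'w \<Rightarrow> 'n" and X :: "nat \<Rightarrow> 'w \<Rightarrow> real ^ 'n" and t :: nat
  assumes "\<gamma> \<ge> 0" and "\<And>i. \<beta> i > 0" and "\<alpha> > 0"
    and "\<And>x. f differentiable (at x)"
    and "\<And>y. f xstar \<le> f y"
    and "strongly_convex_wrt (wnorm \<beta> (1 - \<gamma>)) \<alpha> f"
    and "\<And>i. coord_smooth f i (\<beta> i)"
    and "prob_space M"
    and "rcd_process M \<beta> \<gamma> f x1 I X"
  shows "prob_space.expectation M (\<lambda>\<omega>. f (X (t + 1) \<omega>)) - f xstar
           \<le> (1 - 1 / kappa \<beta> \<alpha> \<gamma>) ^ t * (f x1 - f xstar)"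
proof -
  interpret prob_space M by fact
  let ?T = "coordinate_step \<beta> f"
  have indep: "indep_vars (\<lambda>_. count_space UNIV) I {1..}"
    and law: "\<And>s i. s \<ge> 1 \<Longrightarrow> prob {\<omega> \<in> space M. I s \<omega> = i} = rcd_prob \<beta> \<gamma> i"
    using assms(9) by (auto simp: rcd_process_def)
  have "integrable M (\<lambda>\<omega>. f (iterate_steps ?T x1 (restrict (\<lambda>s. I s \<omega>) {1..t}) t))"
    by (rule integrable_function_of_history) (use indep in \<open>auto simp: indep_vars_def\<close>)
  also have "(\<lambda>\<omega>. f (iterate_steps ?T x1 (restrict (\<lambda>s. I s \<omega>) {1..t}) t))
      = (\<lambda>\<omega>. f (iterate_steps ?T x1 (\<lambda>s. I s \<omega>) t))"
    by (intro ext arg_cong[of _ _ f] iterate_steps_cong) simp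
  finally have int: "integrable M (\<lambda>\<omega>. f (iterate_steps ?T x1 (\<lambda>s. I s \<omega>) t))" .
  have "expectation (\<lambda>\<omega>. f (X (t + 1) \<omega>))
      = expectation (\<lambda>\<omega>. f (iterate_steps ?T x1 (\<lambda>s. I s \<omega>) t))"
    by (intro Bochner_Integration.integral_cong refl arg_cong[of _ _ f]
        rcd_process_eq_iterate_steps[OF assms(9)])
  then have "expectation (\<lambda>\<omega>. f (X (t + 1) \<omega>)) - f xstar
      = expectation (\<lambda>\<omega>. f (iterate_steps ?T x1 (\<lambda>s. I s \<omega>) t) - f xstar)"
    using int by (simp add: prob_space)
  also have "\<dots> \<le> (1 - 1 / kappa \<beta> \<alpha> \<gamma>) ^ t * (f x1 - f xstar)"
  proof (rule expectation_iterate_le[where V = "\<lambda>x. f x - f xstar", OF indep law])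
    show "(\<Sum>i\<in>UNIV. rcd_prob \<beta> \<gamma> i * (f (?T i x) - f xstar))
        \<le> (1 - 1 / kappa \<beta> \<alpha> \<gamma>) * (f x - f xstar)" for x
      using assms by (intro mean_gap_contraction)
    show "1 - 1 / kappa \<beta> \<alpha> \<gamma> \<ge> 0"
      using kappa_ge_1[OF assms(6,7,2,3)] by simp
  qed
  finally show ?thesis .
qed

end
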